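(* Let $h:\mathbb{R}^n\to\overline{\mathbb{R}}$ be a proper function with convex domain, and let $\overline{x}\in\arg\min_{\mathbb{R}^n}h$. Assume that $h$ is $(\kappa,\gamma)$-strongly quasar-convex with respect to $\overline{x}$, where $\kappa\in(0,1]$ and $\gamma\ge 0$, and that $h$ is locally Lipschitz on $\mathrm{dom}(h)$. If $0\in\partial^Ch(x)$, then $x\in\arg\min_{\mathbb{R}^n}h$.
   Context: $\overline{\mathbb{R}}=\mathbb{R}\cup\{+\infty\}$; $\mathrm{dom}(h)=\{x:h(x)<+\infty\}$; $h$ is proper if $\mathrm{dom}(h)\neq\emptyset$; $\|\cdot\|$ is the Euclidean norm. Locally Lipschitz on $\mathrm{dom}(h)$ means that every $x\in\mathrm{dom}(h)$ has an open neighborhood in $\mathbb{R}^n$ on which $h$ is (finite and) Lipschitz. Let $\kappa\in(0,1]$, $\gamma\ge 0$. A proper function $h:\mathbb{R}^n\to\overline{\mathbb{R}}$ with convex domain and $\arg\min_{\mathbb{R}^n}h\neq\emptyset$ is called $(\kappa,\gamma)$-strongly quasar-convex with respect to $\overline{x}\in\arg\min_{\mathbb{R}^n}h$ if for all $x\in\mathrm{dom}(h)$ and all $\lambda\in[0,1]$, $$h(\lambda\overline{x}+(1-\lambda)x)\le\kappa\lambda h(\overline{x})+(1-\kappa\lambda)h(x)-\lambda\left(1-\frac{\lambda}{2-\kappa}\right)\frac{\kappa\gamma}{2}\|x-\overline{x}\|^2.$$ The Clarke directional derivative is $h^\circ(x;d)=\limsup_{y\to x,\,t\downarrow 0}\frac{h(y+td)-h(y)}{t}$,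 and the Clarke subdifferential is $\partial^Ch(x)=\{v\in\mathbb{R}^n:\langle v,d\rangle\le h^\circ(x;d)\ \forall d\in\mathbb{R}^n\}$ for $x\in\mathrm{dom}(h)$, and $\partial^Ch(x)=\emptyset$ otherwise. *)

theory Defs
  imports "HOL-Analysis.Analysis"
begin

text \<open>
  Functions with values in \<open>\<real> \<union> {+\<infinity>}\<close> are rendered as functions into
  \<^typ>\<open>ereal\<close> that never take the value \<open>-\<infinity>\<close>.  The definitions below are meant for such
  functions; their exclusion of \<open>-\<infinity>\<close> is stated separately by \<open>avoids_minus_infinity\<close>.
\<close>

definition avoids_minus_infinity :: "(real ^ 'n \<Rightarrow> ereal) \<Rightarrow> bool" where
  "avoids_minus_infinity h \<longleftrightarrow> (\<forall>x. h x \<noteq> -\<infinity>)"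

definition edom :: "(real ^ 'n \<Rightarrow> ereal) \<Rightarrow> (real ^ 'n) set" where
  "edom h = {x. h x < \<infinity>}"

definition proper :: "(real ^ 'n \<Rightarrow> ereal) \<Rightarrow> bool" where
  "proper h \<longleftrightarrow> edom h \<noteq> {}"

definition argmin :: "(real ^ 'n \<Rightarrow> ereal) \<Rightarrow> (real ^ 'n) set" where
  "argmin h = {x. is_arg_min h (\<lambda>_. True) x}"

text \<open>
  All values of \<open>h\<close> in the inequality are finite when \<open>h\<close> avoids \<open>-\<infinity>\<close>: \<open>xbar\<close> and \<open>x\<close> lie in
  the convex domain, hence so does the convex combination.
\<close>

definition strongly_quasar_convex ::
    "real \<Rightarrow> real \<Rightarrow> (real ^ 'n \<Rightarrow> ereal) \<Rightarrow> real ^ 'n \<Rightarrow> bool" where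
  "strongly_quasar_convex \<kappa> \<gamma> h xbar \<longleftrightarrow>
     proper h \<and> convex (edom h) \<and> xbar \<in> argmin h \<and>
     (\<forall>x \<in> edom h. \<forall>s \<in> {0..1::real}.
        h (s *\<^sub>R xbar + (1 - s) *\<^sub>R x)
          \<le> ereal (\<kappa> * s) * h xbar + ereal (1 - \<kappa> * s) * h x
            - ereal (s * (1 - s / (2 - \<kappa>)) * (\<kappa> * \<gamma> / 2) * (norm (x - xbar))\<^sup>2))"

text \<open>
  The neighborhood is open in the whole space and contained in the domain, so
  \<^const>\<open>real_of_ereal\<close> is only applied to finite values.
\<close>

definition locally_Lipschitz_on_edom :: "(real ^ 'n \<Rightarrow> ereal) \<Rightarrow> bool" where
  "locally_Lipschitz_on_edom h \<longleftrightarrow>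
     (\<forall>x \<in> edom h. \<exists>U L. open U \<and> x \<in> U \<and> U \<subseteq> edom h \<and>
        L-lipschitz_on U (\<lambda>y. real_of_ereal (h y)))"

text \<open>
  The limit superior ranges over \<open>y\<close> near \<open>x\<close> (with \<open>y = x\<close> allowed) and small \<open>t > 0\<close>, jointly.
\<close>

definition clarke_dir_deriv ::
    "(real ^ 'n \<Rightarrow> ereal) \<Rightarrow> real ^ 'n \<Rightarrow> real ^ 'n \<Rightarrow> ereal" where
  "clarke_dir_deriv h x d =
     Limsup (nhds x \<times>\<^sub>F at_right (0::real))
       (\<lambda>(y, t). (h (y + t *\<^sub>R d) - h y) / ereal t)"

definition clarke_subdiff :: "(real ^ 'n \<Rightarrow> ereal) \<Rightarrow> real ^ 'n \<Rightarrow> (real ^ 'n) set" where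
  "clarke_subdiff h x =
     (if x \<in> edom h then {v. \<forall>d. ereal (v \<bullet> d) \<le> clarke_dir_deriv h x d} else {})"

end

theory Submission
  imports Defs
begin

text \<open>
  The key fact is the estimate
  \<open>h\<degree>(x; xbar - x) \<le> - \<kappa> (h x - h xbar)\<close> for every \<open>x\<close> in the domain
  (\<open>clarke_dir_deriv_toward_minimizer_le\<close>).  It says that a quasar-convex function decreases,
  even in Clarke's sense, in the direction of its minimizer, at a rate proportional to the
  optimality gap.  If \<open>0\<close> is a Clarke subgradient at \<open>x\<close>, then \<open>0 \<le> h\<degree>(x; xbar - x)\<close>, so the gap
  vanishes.

  For the estimate, let \<open>y\<close> be close to \<open>x\<close> and \<open>t > 0\<close> small.  Dropping the nonpositive
  \<open>\<gamma>\<close>-term, quasar-convexity at \<open>y\<close> gives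
  \<open>h (y + t (xbar - y)) - h y \<le> - t \<kappa> (h y - h xbar)\<close>.
  The Clarke quotient moves \<open>y\<close> along \<open>xbar - x\<close> and not along \<open>xbar - y\<close>.  The two
  end points differ by \<open>t (y - x)\<close>, so if \<open>L\<close> is a Lipschitz constant near \<open>x\<close>, the quotient
  changes by at most \<open>L \<parallel>y - x\<parallel>\<close>.  Both this error and \<open>\<kappa> (h y - h x)\<close> vanish as \<open>y \<rightarrow> x\<close>.
\<close>

lemma ereal_real_of_edom:
  assumes "avoids_minus_infinity h" and "x \<in> edom h"
  shows "ereal (real_of_ereal (h x)) = h x"
  using assms by (cases "h x") (auto simp: avoids_minus_infinity_def edom_def)

lemma argmin_le: "xbar \<in> argmin h \<Longrightarrow> h xbar \<le> h x"
  by (auto simp: argmin_def is_arg_min_def not_less)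

lemma argmin_in_edom:
  assumes "xbar \<in> argmin h" and "x \<in> edom h"
  shows "xbar \<in> edom h"
  using argmin_le[OF assms(1), of x] assms(2) by (auto simp: edom_def)

lemma strongly_quasar_convex_imp_quasar_convex:
  assumes fin: "avoids_minus_infinity h" and qc: "strongly_quasar_convex \<kappa> \<gamma> h xbar"
    and "0 \<le> \<kappa>" "\<kappa> \<le> 1" "0 \<le> \<gamma>" and y: "y \<in> edom h" and t: "0 \<le> t" "t \<le> 1"
  defines "z \<equiv> y + t *\<^sub>R (xbar - y)"
  shows "real_of_ereal (h z) - real_of_ereal (h y)
           \<le> - (t * \<kappa> * (real_of_ereal (h y) - real_of_ereal (h xbar)))"
proof -
  define f where "f = (\<lambda>u. real_of_ereal (h u))"
  have cvx: "convex (edom h)" and xb: "xbar \<in> argmin h"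
    using qc by (auto simp: strongly_quasar_convex_def)
  have z: "z = t *\<^sub>R xbar + (1 - t) *\<^sub>R y"
    by (simp add: z_def algebra_simps)
  have xbar: "xbar \<in> edom h"
    using xb y by (rule argmin_in_edom)
  have "z \<in> edom h"
    unfolding z using cvx xbar y t by (intro convexD) auto
  then have eqs: "h z = ereal (f z)" "h y = ereal (f y)" "h xbar = ereal (f xbar)"
    using fin y xbar by (auto simp: f_def ereal_real_of_edom)
  define q where "q = t * (1 - t / (2 - \<kappa>)) * (\<kappa> * \<gamma> / 2) * (norm (y - xbar))\<^sup>2"
  have "t / (2 - \<kappa>) \<le> 1"
    using t \<open>\<kappa> \<le> 1\<close> by (simp add: divide_le_eq)
  then have "0 \<le> q"
    using t \<open>0 \<le> \<kappa>\<close> \<open>0 \<le> \<gamma>\<close> by (simp add: q_def)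
  moreover have "h z \<le> ereal (\<kappa> * t) * h xbar + ereal (1 - \<kappa> * t) * h y - ereal q"
    using qc y t unfolding strongly_quasar_convex_def z q_def by auto
  then have "f z \<le> \<kappa> * t * f xbar + (1 - \<kappa> * t) * f y - q"
    by (simp add: eqs)
  ultimately show ?thesis
    by (simp add: f_def algebra_simps)
qed

lemma clarke_dir_deriv_toward_minimizer_le:
  assumes fin: "avoids_minus_infinity h" and qc: "strongly_quasar_convex \<kappa> \<gamma> h xbar"
    and \<kappa>: "0 \<le> \<kappa>" "\<kappa> \<le> 1" and \<gamma>: "0 \<le> \<gamma>"
    and lip: "locally_Lipschitz_on_edom h" and x: "x \<in> edom h"
  shows "clarke_dir_deriv h x (xbar - x)
           \<le> ereal (- \<kappa> * (real_of_ereal (h x) - real_of_ereal (h xbar)))"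
proof (rule ereal_le_epsilon2)
  fix e :: real assume e: "0 < e"
  define f where "f = (\<lambda>u. real_of_ereal (h u))"
  define d where "d = xbar - x"
  obtain U L where U: "open U" "x \<in> U" "U \<subseteq> edom h" and L: "L-lipschitz_on U f"
    using lip x unfolding locally_Lipschitz_on_edom_def f_def by blast
  have L0: "0 \<le> L"
    using L by (rule lipschitz_on_nonneg)
  obtain r where r: "0 < r" "ball x r \<subseteq> U"
    using U by (meson open_contains_ball)
  have f_diff: "f u - f v \<le> L * norm (u - v)" if "u \<in> ball x r" "v \<in> ball x r" for u v
  proof -
    have "dist (f u) (f v) \<le> L * dist u v"
      using L by (rule lipschitz_onD) (use that r in blast)+
    then show ?thesis
      by (simp add: dist_norm)
  qed
  \<comment> \<open>The first bound on \<open>norm (y - x)\<close>, and the one on \<open>t\<close>, keep all points in the ball of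
    radius \<open>r\<close>; the second makes the total error \<open>(\<kappa> + 1) L \<parallel>y - x\<parallel> \<le> 2 L \<parallel>y - x\<parallel>\<close> at most \<open>e\<close>.\<close>
  define \<delta> where "\<delta> = min (r / 2) (e / (2 * L + 1))"
  define \<tau> where "\<tau> = min 1 (r / (2 * (norm d + 1)))"
  have \<delta>: "0 < \<delta>" and \<tau>: "0 < \<tau>"
    using r e L0 by (auto simp: \<delta>_def \<tau>_def add_nonneg_pos)
  have quot: "(h (y + t *\<^sub>R d) - h y) / ereal t \<le> ereal (- \<kappa> * (f x - f xbar) + e)"
    if y: "norm (y - x) < \<delta>" and t: "0 < t" "t < \<tau>" for y t
  proof -
    have t1: "t \<le> 1"
      using t by (simp add: \<tau>_def)
    have yr: "norm (y - x) < r / 2"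
      using y by (simp add: \<delta>_def)
    have "norm (y - x) * (2 * L + 1) \<le> e"
      using y L0 by (simp add: \<delta>_def pos_less_divide_eq)
    then have err: "2 * (L * norm (y - x)) \<le> e"
      using norm_ge_zero[of "y - x"] by (simp add: distrib_left mult_ac del: norm_ge_zero)
    have "t * (norm d + 1) < r / 2"
      using t by (simp add: \<tau>_def pos_less_divide_eq add_nonneg_pos mult_ac)
    then have td: "norm (t *\<^sub>R d) < r / 2"
      using t by (simp add: algebra_simps)
    define z where "z = y + t *\<^sub>R (xbar - y)"
    have "norm ((y - x) + t *\<^sub>R d) < r"
      using norm_triangle_ineq[of "y - x" "t *\<^sub>R d"] yr td by linarith
    then have w_ball: "y + t *\<^sub>R d \<in> ball x r"
      by (simp add: dist_norm norm_minus_commute[of x] algebra_simps)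
    have "norm ((1 - t) *\<^sub>R (y - x)) \<le> norm (y - x)"
      using t t1 by (simp add: mult_left_le_one_le)
    then have "norm ((1 - t) *\<^sub>R (y - x) + t *\<^sub>R d) < r"
      using norm_triangle_ineq[of "(1 - t) *\<^sub>R (y - x)" "t *\<^sub>R d"] yr td by linarith
    moreover have "z - x = (1 - t) *\<^sub>R (y - x) + t *\<^sub>R d"
      by (simp add: z_def d_def algebra_simps)
    ultimately have z_ball: "z \<in> ball x r"
      by (simp add: dist_norm norm_minus_commute[of x])
    have y_ball: "y \<in> ball x r" and x_ball: "x \<in> ball x r"
      using yr r by (auto simp: dist_norm norm_minus_commute[of x])
    have y_dom: "y \<in> edom h" and w_dom: "y + t *\<^sub>R d \<in> edom h"
      using y_ball w_ball r U by auto
    have "f z - f y \<le> - (t * \<kappa> * (f y - f xbar))"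
      unfolding f_def z_def
      by (rule strongly_quasar_convex_imp_quasar_convex[OF fin qc \<kappa> \<gamma> y_dom])
        (use t t1 in auto)
    moreover have "f (y + t *\<^sub>R d) - f z \<le> t * (L * norm (y - x))"
    proof -
      have "y + t *\<^sub>R d - z = t *\<^sub>R (y - x)"
        by (simp add: z_def d_def algebra_simps)
      then show ?thesis
        using f_diff[OF w_ball z_ball] t by (simp add: mult_ac)
    qed
    moreover have "t * \<kappa> * (f x - f y) \<le> t * (L * norm (y - x))"
    proof -
      have "\<kappa> * (f x - f y) \<le> \<kappa> * (L * norm (y - x))"
        using f_diff[OF x_ball y_ball] \<kappa> by (intro mult_left_mono) (auto simp: norm_minus_commute)
      also have "\<dots> \<le> L * norm (y - x)"
        using \<kappa> L0 by (simp add: mult_left_le_one_le)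
      finally show ?thesis
        using t by (simp add: mult.assoc)
    qed
    moreover have "t * (2 * (L * norm (y - x))) \<le> t * e"
      using err t by (intro mult_left_mono) auto
    ultimately have "f (y + t *\<^sub>R d) - f y \<le> t * (- \<kappa> * (f x - f xbar) + e)"
      by (simp add: algebra_simps)
    then have "(f (y + t *\<^sub>R d) - f y) / t \<le> - \<kappa> * (f x - f xbar) + e"
      using t by (simp add: pos_divide_le_eq mult_ac)
    moreover have "h (y + t *\<^sub>R d) = ereal (f (y + t *\<^sub>R d))" "h y = ereal (f y)"
      using fin y_dom w_dom by (auto simp: f_def ereal_real_of_edom)
    ultimately show ?thesis
      using t by simp
  qed
  have "eventually (\<lambda>y. norm (y - x) < \<delta>) (nhds x)"
    using \<delta> by (auto simp: eventually_nhds_metric dist_norm)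
  moreover have "eventually (\<lambda>t. 0 < t \<and> t < \<tau>) (at_right 0)"
    using \<tau> by (auto simp: eventually_at_right_field)
  ultimately have "eventually (\<lambda>(y, t). (h (y + t *\<^sub>R d) - h y) / ereal t
      \<le> ereal (- \<kappa> * (f x - f xbar) + e)) (nhds x \<times>\<^sub>F at_right 0)"
    unfolding eventually_prod_filter using quot by fast
  then have "clarke_dir_deriv h x d \<le> ereal (- \<kappa> * (f x - f xbar) + e)"
    unfolding clarke_dir_deriv_def by (intro Limsup_bounded) (simp add: case_prod_unfold)
  then show "clarke_dir_deriv h x (xbar - x)
      \<le> ereal (- \<kappa> * (real_of_ereal (h x) - real_of_ereal (h xbar))) + ereal e"
    by (simp add: d_def f_def)
qed

theorem proposition33:
  fixes h :: "real ^ 'n \<Rightarrow> ereal" and xbar x :: "real ^ 'n" and \<kappa> \<gamma> :: real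
  assumes "avoids_minus_infinity h"
    and "proper h"
    and "convex (edom h)"
    and "xbar \<in> argmin h"
    and "0 < \<kappa>" and "\<kappa> \<le> 1"
    and "0 \<le> \<gamma>"
    and "strongly_quasar_convex \<kappa> \<gamma> h xbar"
    and "locally_Lipschitz_on_edom h"
    and "0 \<in> clarke_subdiff h x"
  shows "x \<in> argmin h"
proof -
  have x: "x \<in> edom h" and sub: "\<And>d. 0 \<le> clarke_dir_deriv h x d"
    using assms(10) by (auto simp: clarke_subdiff_def zero_ereal_def split: if_splits)
  have xbar: "xbar \<in> edom h"
    using assms(4) x by (rule argmin_in_edom)
  have "0 \<le> clarke_dir_deriv h x (xbar - x)"
    by (rule sub)
  also have "\<dots> \<le> ereal (- \<kappa> * (real_of_ereal (h x) - real_of_ereal (h xbar)))"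
    using assms x by (intro clarke_dir_deriv_toward_minimizer_le) auto
  finally have "\<kappa> * (real_of_ereal (h x) - real_of_ereal (h xbar)) \<le> 0"
    by simp
  then have "real_of_ereal (h x) \<le> real_of_ereal (h xbar)"
    using \<open>0 < \<kappa>\<close> by (simp add: mult_le_0_iff)
  then have "h x \<le> h xbar"
    using ereal_real_of_edom[OF assms(1) x] ereal_real_of_edom[OF assms(1) xbar]
    by (metis ereal_less_eq(3))
  then have "h x \<le> h u" for u
    using argmin_le[OF assms(4), of u] by (rule order_trans)
  then show ?thesis
    by (simp add: argmin_def is_arg_min_def not_less)
qed

end
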